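(* For every integer $n \ge 1$, $\mathsf{rc}(n) \le 17^n$.
   Context: A finite point set in the plane is in general position if no two of its points share the same $x$-coordinate or the same $y$-coordinate. Let $B$ be an axis-parallel rectangle and $P$ a set of $n$ points in general position in the interior of $B$. A rectangulation of $(B,P)$ is a partition of $B$ into rectangles by axis-parallel segments such that every segment contains exactly one point of $P$, each point of $P$ lies on exactly one segment (so segments are in bijection with points of $P$), and segments do not intersect in their interiors (an endpoint of one segment may lie in the interior of another segment or on the boundary of $B$). Let $\mathsf{rc}(P)$ denote the number of rectangulations of $(B,P)$, and let $\mathsf{rc}(n)$ be the maximum of $\mathsf{rc}(P)$ over all sets $P$ of $n$ points in general position. *)

theory Defs
  imports "HOL-Analysis.Analysis" "HOL-Library.Extended_Nat"
begin

definition general_position :: "(real \<times> real) set \<Rightarrow> bool" where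
  "general_position P \<longleftrightarrow> finite P \<and> inj_on fst P \<and> inj_on snd P"

definition axis_rectangle :: "(real \<times> real) set \<Rightarrow> bool" where
  "axis_rectangle R \<longleftrightarrow> (\<exists>a b. R = cbox a b \<and> box a b \<noteq> {})"

definition axis_segment :: "(real \<times> real) set \<Rightarrow> bool" where
  "axis_segment s \<longleftrightarrow>
     (\<exists>a b. s = closed_segment a b \<and> a \<noteq> b \<and> (fst a = fst b \<or> snd a = snd b))"

text \<open>
  The segments of \<open>S\<close> cut \<open>B\<close> into rectangles: \<open>B\<close> is tiled by finitely many
  non-degenerate rectangles whose sides cover exactly the boundary of \<open>B\<close> together
  with the segments of \<open>S\<close>. In particular no segment has a dangling end.
\<close>

definition cuts_into_rectangles ::
    "(real \<times> real) set \<Rightarrow> (real \<times> real) set set \<Rightarrow> bool" where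
  "cuts_into_rectangles B S \<longleftrightarrow>
     (\<exists>D. D division_of B \<and> (\<forall>R\<in>D. axis_rectangle R) \<and>
          (\<Union>R\<in>D. frontier R) = frontier B \<union> \<Union>S)"

text \<open>
  A rectangulation is identified with its set of segments. The relative interior of a
  segment is the segment without its two endpoints, so T-shaped contacts are allowed
  while proper crossings are not.
\<close>

definition rectangulation ::
    "(real \<times> real) set \<Rightarrow> (real \<times> real) set \<Rightarrow> (real \<times> real) set set \<Rightarrow> bool" where
  "rectangulation B P S \<longleftrightarrow>
     (\<forall>s\<in>S. axis_segment s \<and> s \<subseteq> B) \<and>
     (\<forall>s\<in>S. \<exists>!p. p \<in> P \<and> p \<in> s) \<and>
     (\<forall>p\<in>P. \<exists>!s. s \<in> S \<and> p \<in> s) \<and>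
     pairwise (\<lambda>s t. disjnt (rel_interior s) (rel_interior t)) S \<and>
     cuts_into_rectangles B S"

text \<open>
  The counts are extended naturals: an infinite family of rectangulations, or an
  unbounded family of counts, gives \<open>\<infinity>\<close> (and not \<open>0\<close>, as with \<^const>\<open>card\<close> or the
  supremum on \<^typ>\<open>nat\<close>). A finite supremum of a non-empty set of extended naturals is
  attained, hence is a maximum.
\<close>

definition rc :: "(real \<times> real) set \<Rightarrow> (real \<times> real) set \<Rightarrow> enat" where
  "rc B P = (if finite {S. rectangulation B P S}
             then enat (card {S. rectangulation B P S}) else \<infinity>)"

definition rc_max :: "nat \<Rightarrow> enat" where
  "rc_max n = Sup {rc B P | B P.
     axis_rectangle B \<and> general_position P \<and> P \<subseteq> interior B \<and> card P = n}"

end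

theory Submission
  imports Defs
begin

text \<open>
  A rectangulation is encoded by recording for every point whether its segment is vertical and, if
  so, how many horizontal segments end on it from the left and from the right, separately above and
  below the point. The code determines the rectangulation: if \<open>R\<close> and \<open>R'\<close> have equal codes, consider
  the leftmost vertical segment at which some horizontal segment coming from the left ends in \<open>R'\<close>
  but at a height that the vertical segment does not reach in \<open>R\<close>. Since the counts agree,
  another horizontal segment ends there in \<open>R\<close> but not in \<open>R'\<close>, and the place where it ends in \<open>R'\<close>
  is a new contact further left. So there are no new contacts, hence no vertical segment is longer
  in \<open>R'\<close> than in \<open>R\<close>.

  As each horizontal segment has only two ends, assigning weight \<open>9\<close> to a horizontal segment and
  \<open>3\<^sup>-\<^sup>k\<close> to a vertical one with \<open>k\<close> contacts gives each code a weight of at least \<open>1\<close>, while the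
  total weight of all codes is at most \<open>(9 + (3/2)\<^sup>4)\<^sup>n = (225/16)\<^sup>n\<close>.
\<close>

section \<open>Configurations of horizontal and vertical segments\<close>

text \<open>An end is either on the side of the bounding box or strictly inside a perpendicular
  segment. The coordinates \<open>X\<close>, \<open>Y\<close> are parameters, so that mirror images
  are again instances.\<close>

locale floorplan =
  fixes H V :: "'a set" and X Y :: "'a \<Rightarrow> real" and x0 x1 y0 y1 :: real
    and l r b t :: "'a \<Rightarrow> real"
  assumes finite_H: "finite H" and finite_V: "finite V"
    and inj_X: "inj_on X (H \<union> V)" and inj_Y: "inj_on Y (H \<union> V)" and disjoint: "H \<inter> V = {}"
    and hor: "\<And>q. q \<in> H \<Longrightarrow> l q \<le> X q \<and> X q \<le> r q"
    and ver: "\<And>p. p \<in> V \<Longrightarrow> b p \<le> Y p \<and> Y p \<le> t p"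
    and ver_bounds: "\<And>p. p \<in> V \<Longrightarrow> x0 < X p \<and> X p < x1 \<and> y0 \<le> b p \<and> t p \<le> y1"
    and hor_bounds: "\<And>q. q \<in> H \<Longrightarrow> x0 \<le> l q \<and> r q \<le> x1"
    and no_crossing: "\<And>p q. \<lbrakk>q \<in> H; p \<in> V; l q < X p; X p < r q; b p < Y q; Y q < t p\<rbrakk> \<Longrightarrow> False"
    and right_end: "\<And>q. \<lbrakk>q \<in> H; r q \<noteq> x1\<rbrakk> \<Longrightarrow> \<exists>p\<in>V. X p = r q \<and> b p < Y q \<and> Y q < t p"
    and left_end: "\<And>q. \<lbrakk>q \<in> H; l q \<noteq> x0\<rbrakk> \<Longrightarrow> \<exists>p\<in>V. X p = l q \<and> b p < Y q \<and> Y q < t p"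
    and top_end: "\<And>p. \<lbrakk>p \<in> V; t p \<noteq> y1\<rbrakk> \<Longrightarrow> \<exists>q\<in>H. Y q = t p \<and> l q < X p \<and> X p < r q"
    and bottom_end: "\<And>p. \<lbrakk>p \<in> V; b p \<noteq> y0\<rbrakk> \<Longrightarrow> \<exists>q\<in>H. Y q = b p \<and> l q < X p \<and> X p < r q"
begin

lemma X_neq: "p \<in> V \<Longrightarrow> q \<in> H \<Longrightarrow> X p \<noteq> X q"
  using inj_X disjoint by (metis IntI UnCI empty_iff inj_onD)

lemma Y_neq: "p \<in> V \<Longrightarrow> q \<in> H \<Longrightarrow> Y p \<noteq> Y q"
  using inj_Y disjoint by (metis IntI UnCI empty_iff inj_onD)

end

text \<open>The flag \<open>k\<close> distinguishes the contacts above and below the point of \<open>p\<close>; \<open>e\<close> is the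
  coordinate function of the right (or left) ends.\<close>

definition contacts ::
  "'a set \<Rightarrow> ('a \<Rightarrow> real) \<Rightarrow> ('a \<Rightarrow> real) \<Rightarrow> ('a \<Rightarrow> real) \<Rightarrow> ('a \<Rightarrow> real) \<Rightarrow> ('a \<Rightarrow> real) \<Rightarrow> bool \<Rightarrow> 'a \<Rightarrow> 'a set"
  where "contacts H X Y e b t k p =
    {q \<in> H. e q = X p \<and> b p < Y q \<and> Y q < t p \<and> (Y p < Y q \<longleftrightarrow> k)}"

lemma finite_contacts: "finite H \<Longrightarrow> finite (contacts H X Y e b t k p)"
  by (simp add: contacts_def)

text \<open>Negating \<open>X\<close> exchanges left and right ends, so whatever is shown for right
  ends carries over to left ends.\<close>

lemma floorplan_reflect:
  assumes "floorplan H V X Y x0 x1 y0 y1 l r b t"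
  shows "floorplan H V (\<lambda>p. - X p) Y (- x1) (- x0) y0 y1 (\<lambda>p. - r p) (\<lambda>p. - l p) b t"
proof -
  interpret floorplan H V X Y x0 x1 y0 y1 l r b t by fact
  show ?thesis
  proof
    show "inj_on (\<lambda>p. - X p) (H \<union> V)"
      using inj_X by (simp add: inj_on_def)
  next
    fix p assume "p \<in> V" "t p \<noteq> y1"
    with top_end[of p] show "\<exists>q\<in>H. Y q = t p \<and> - r q < - X p \<and> - X p < - l q" by auto
  next
    fix p assume "p \<in> V" "b p \<noteq> y0"
    with bottom_end[of p] show "\<exists>q\<in>H. Y q = b p \<and> - r q < - X p \<and> - X p < - l q" by auto
  next
    fix p q assume "q \<in> H" "p \<in> V" "- r q < - X p" "- X p < - l q" "b p < Y q" "Y q < t p"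
    then show False using no_crossing[of q p] by auto
  qed (use finite_H finite_V inj_Y disjoint hor ver ver_bounds hor_bounds right_end left_end in auto)
qed

text \<open>At the leftmost new contact some old contact of the same vertical segment is lost, hence
  its horizontal segment now stops earlier, which gives a new contact further left.\<close>

lemma no_new_right_contact:
  assumes 1: "floorplan H V X Y x0 x1 y0 y1 l r b t"
    and 2: "floorplan H V X Y x0 x1 y0 y1 l' r' b' t'"
    and eq: "\<And>p k. p \<in> V \<Longrightarrow>
      card (contacts H X Y r b t k p) = card (contacts H X Y r' b' t' k p)"
    and "p \<in> V" "q \<in> H" "r' q = X p" "b' p < Y q" "Y q < t' p" "\<not> (b p < Y q \<and> Y q < t p)"
  shows False
proof -
  interpret A: floorplan H V X Y x0 x1 y0 y1 l r b t by fact
  interpret B: floorplan H V X Y x0 x1 y0 y1 l' r' b' t' by fact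
  define gain where "gain p \<longleftrightarrow> p \<in> V \<and>
    (\<exists>q\<in>H. r' q = X p \<and> b' p < Y q \<and> Y q < t' p \<and> \<not> (b p < Y q \<and> Y q < t p))" for p
  have "finite {p. gain p}" "{p. gain p} \<noteq> {}"
    using A.finite_V assms(4-9) by (auto simp: gain_def)
  then obtain p where p: "gain p" and least: "\<And>p'. gain p' \<Longrightarrow> X p \<le> X p'"
    using arg_min_if_finite[of "{p. gain p}" X] by (metis mem_Collect_eq not_le)
  then obtain q where q: "p \<in> V" "q \<in> H" "r' q = X p" "b' p < Y q" "Y q < t' p"
      "\<not> (b p < Y q \<and> Y q < t p)" by (auto simp: gain_def)
  define k where "k \<longleftrightarrow> Y p < Y q"
  let ?L = "contacts H X Y r b t k p" and ?L' = "contacts H X Y r' b' t' k p"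
  have "q \<in> ?L'" "q \<notin> ?L" using q by (auto simp: contacts_def k_def)
  moreover have "card ?L = card ?L'" using eq q by blast
  ultimately have "\<not> ?L \<subseteq> ?L'"
    using card_subset_eq[OF finite_contacts[OF A.finite_H]] by metis
  then obtain q' where q': "q' \<in> ?L" "q' \<notin> ?L'" by blast
  then have h: "q' \<in> H" "r q' = X p" "b p < Y q'" "Y q' < t p" "Y p < Y q' \<longleftrightarrow> k"
    by (auto simp: contacts_def)
  \<comment> \<open>Separate counts above and below matter here: \<open>q\<close> and
    \<open>q'\<close> lie on the same side of the point of \<open>p\<close>, and \<open>q\<close> is
    out of reach of \<open>p\<close> in the first configuration, so \<open>Y q'\<close> is between
    \<open>Y p\<close> and \<open>Y q\<close>.\<close>
  have c: "b' p < Y q'" "Y q' < t' p"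
    using h q A.ver[OF q(1)] B.ver[OF q(1)] A.Y_neq[OF q(1) q(2)] A.Y_neq[OF q(1) h(1)]
    by (auto simp: k_def)
  have "X q' < X p" using A.hor[OF h(1)] h(2) A.X_neq[OF q(1) h(1)] by auto
  then have "r' q' \<le> X p"
    using B.no_crossing[OF h(1) q(1)] c B.hor[OF h(1)] by force
  moreover have "r' q' \<noteq> X p" using q'(2) h c by (auto simp: contacts_def)
  ultimately have lt: "r' q' < X p" by simp
  then obtain p' where p': "p' \<in> V" "X p' = r' q'" "b' p' < Y q'" "Y q' < t' p'"
    using B.right_end[OF h(1)] A.ver_bounds[OF q(1)] by force
  have "X q' < X p'" using B.hor[OF h(1)] p' A.X_neq[OF p'(1) h(1)] by auto
  \<comment> \<open>In the first configuration \<open>q'\<close> runs on to \<open>X p\<close>, past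
    \<open>X p'\<close>, and may not cross \<open>p'\<close>. So the contact of \<open>q'\<close>
    with \<open>p'\<close> is new.\<close>
  then have "\<not> (b p' < Y q' \<and> Y q' < t p')"
    using A.no_crossing[OF h(1) p'(1)] A.hor[OF h(1)] lt h(2) p'(2) by auto
  then have "gain p'" using p' h(1) by (auto simp: gain_def)
  with least lt p'(2) show False by force
qed

lemma contacts_reflect:
  "contacts H (\<lambda>p. - X p) Y (\<lambda>p. - l p) b t k p = contacts H X Y l b t k p"
  by (auto simp: contacts_def)

lemma no_new_left_contact:
  assumes "floorplan H V X Y x0 x1 y0 y1 l r b t"
    and "floorplan H V X Y x0 x1 y0 y1 l' r' b' t'"
    and "\<And>p k. p \<in> V \<Longrightarrow>
      card (contacts H X Y l b t k p) = card (contacts H X Y l' b' t' k p)"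
    and "p \<in> V" "q \<in> H" "l' q = X p" "b' p < Y q" "Y q < t' p" "\<not> (b p < Y q \<and> Y q < t p)"
  shows False
  using no_new_right_contact[OF floorplan_reflect[OF assms(1)] floorplan_reflect[OF assms(2)],
      of p q] assms(3-9)
  by (simp add: contacts_reflect)

text \<open>Extends the exclusion from contacts to horizontal segments that pass \<open>X p\<close>
  in the first configuration. In the second one \<open>q\<close> cannot cross \<open>p\<close>, so
  it ends on \<open>p\<close> or on an earlier vertical segment. Either contact would be
  new.\<close>

lemma no_new_coverage_from_left:
  assumes 1: "floorplan H V X Y x0 x1 y0 y1 l r b t"
    and 2: "floorplan H V X Y x0 x1 y0 y1 l' r' b' t'"
    and eq: "\<And>p k. p \<in> V \<Longrightarrow>
      card (contacts H X Y r b t k p) = card (contacts H X Y r' b' t' k p)"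
    and p: "p \<in> V" and q: "q \<in> H" and "X q < X p" "X p < r q" "b' p < Y q" "Y q < t' p"
      "\<not> (b p < Y q \<and> Y q < t p)"
  shows False
proof -
  interpret A: floorplan H V X Y x0 x1 y0 y1 l r b t by fact
  interpret B: floorplan H V X Y x0 x1 y0 y1 l' r' b' t' by fact
  note no_new = no_new_right_contact[OF 1 2 eq]
  have "r' q \<noteq> X p" using no_new[OF _ p q] assms by blast
  moreover have "r' q \<le> X p"
    using B.no_crossing[OF q p] assms(6-9) B.hor[OF q] by force
  ultimately have lt: "r' q < X p" by simp
  then obtain p' where p': "p' \<in> V" "X p' = r' q" "b' p' < Y q" "Y q < t' p'"
    using B.right_end[OF q] A.ver_bounds[OF p] by force
  have "X q < X p'" using B.hor[OF q] p' A.X_neq[OF p'(1) q] by auto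
  then have "\<not> (b p' < Y q \<and> Y q < t p')"
    using A.no_crossing[OF q p'(1)] A.hor[OF q] lt assms(7) p'(2) by auto
  then show False using no_new[OF _ p'(1) q] p' by auto
qed

text \<open>If the point of \<open>q\<close> lies to the right of \<open>p\<close>, the mirror image
  reduces to the previous lemma.\<close>

lemma no_new_coverage:
  assumes 1: "floorplan H V X Y x0 x1 y0 y1 l r b t"
    and 2: "floorplan H V X Y x0 x1 y0 y1 l' r' b' t'"
    and eqr: "\<And>p k. p \<in> V \<Longrightarrow>
      card (contacts H X Y r b t k p) = card (contacts H X Y r' b' t' k p)"
    and eql: "\<And>p k. p \<in> V \<Longrightarrow>
      card (contacts H X Y l b t k p) = card (contacts H X Y l' b' t' k p)"
    and p: "p \<in> V" and q: "q \<in> H" and x: "l q < X p" "X p < r q" and y: "b' p < Y q" "Y q < t' p"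
      "\<not> (b p < Y q \<and> Y q < t p)"
  shows False
proof -
  have "X p \<noteq> X q" using floorplan.X_neq[OF 1 p q] .
  then consider "X q < X p" | "X p < X q" by linarith
  then show False
  proof cases
    case 1
    show ?thesis
      by (rule no_new_coverage_from_left[OF assms(1,2) eqr p q 1 x(2) y])
  next
    case 2
    show ?thesis
      using no_new_coverage_from_left[OF floorplan_reflect[OF assms(1)]
          floorplan_reflect[OF assms(2)] _ p q _ _ y] eql 2 x(1)
      by (simp add: contacts_reflect)
  qed
qed

section \<open>Uniqueness of a configuration with given contact counts\<close>

text \<open>An end of \<open>p\<close> inside the box lies on some \<open>q\<close> in the first
  configuration. If \<open>p\<close> were longer in the second one, it would newly cover the height
  of \<open>q\<close>.\<close>

lemma ver_le:
  assumes 1: "floorplan H V X Y x0 x1 y0 y1 l r b t"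
    and 2: "floorplan H V X Y x0 x1 y0 y1 l' r' b' t'"
    and eqr: "\<And>p k. p \<in> V \<Longrightarrow>
      card (contacts H X Y r b t k p) = card (contacts H X Y r' b' t' k p)"
    and eql: "\<And>p k. p \<in> V \<Longrightarrow>
      card (contacts H X Y l b t k p) = card (contacts H X Y l' b' t' k p)"
    and p: "p \<in> V"
  shows "b p \<le> b' p" "t' p \<le> t p"
proof -
  interpret A: floorplan H V X Y x0 x1 y0 y1 l r b t by fact
  interpret B: floorplan H V X Y x0 x1 y0 y1 l' r' b' t' by fact
  note no_new = no_new_coverage[OF 1 2 eqr eql p]
  show "b p \<le> b' p"
  proof (rule ccontr)
    assume lt: "\<not> b p \<le> b' p"
    with B.ver_bounds[OF p] have "b p \<noteq> y0" by auto
    then obtain q where q: "q \<in> H" "Y q = b p" "l q < X p" "X p < r q"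
      using A.bottom_end p by blast
    have "Y q < t' p" using q(2) A.ver[OF p] B.ver[OF p] A.Y_neq[OF p q(1)] by linarith
    then show False using no_new[of q] q lt by auto
  qed
  show "t' p \<le> t p"
  proof (rule ccontr)
    assume lt: "\<not> t' p \<le> t p"
    with B.ver_bounds[OF p] have "t p \<noteq> y1" by auto
    then obtain q where q: "q \<in> H" "Y q = t p" "l q < X p" "X p < r q"
      using A.top_end p by blast
    have "b' p < Y q" using q(2) A.ver[OF p] B.ver[OF p] A.Y_neq[OF p q(1)] by linarith
    then show False using no_new[of q] q lt by auto
  qed
qed

text \<open>Once the vertical segments agree, a horizontal segment that is longer in the second
  configuration would cross the vertical segment that stops it in the first.\<close>

lemma hor_le:
  assumes 1: "floorplan H V X Y x0 x1 y0 y1 l r b t"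
    and 2: "floorplan H V X Y x0 x1 y0 y1 l' r' b' t'"
    and eq: "\<And>p. p \<in> V \<Longrightarrow> b p = b' p \<and> t p = t' p"
    and q: "q \<in> H"
  shows "l q \<le> l' q" "r' q \<le> r q"
proof -
  interpret A: floorplan H V X Y x0 x1 y0 y1 l r b t by fact
  interpret B: floorplan H V X Y x0 x1 y0 y1 l' r' b' t' by fact
  show "l q \<le> l' q"
  proof (rule ccontr)
    assume lt: "\<not> l q \<le> l' q"
    with B.hor_bounds[OF q] have "l q \<noteq> x0" by auto
    then obtain p where p: "p \<in> V" "X p = l q" "b p < Y q" "Y q < t p"
      using A.left_end q by blast
    have "X p < r' q" using p(2) A.hor[OF q] B.hor[OF q] A.X_neq[OF p(1) q] by linarith
    then show False using B.no_crossing[OF q p(1)] p lt eq[OF p(1)] by auto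
  qed
  show "r' q \<le> r q"
  proof (rule ccontr)
    assume lt: "\<not> r' q \<le> r q"
    with B.hor_bounds[OF q] have "r q \<noteq> x1" by auto
    then obtain p where p: "p \<in> V" "X p = r q" "b p < Y q" "Y q < t p"
      using A.right_end q by blast
    have "l' q < X p" using p(2) A.hor[OF q] B.hor[OF q] A.X_neq[OF p(1) q] by linarith
    then show False using B.no_crossing[OF q p(1)] p lt eq[OF p(1)] by auto
  qed
qed

lemma floorplan_unique:
  assumes 1: "floorplan H V X Y x0 x1 y0 y1 l r b t"
    and 2: "floorplan H V X Y x0 x1 y0 y1 l' r' b' t'"
    and eqr: "\<And>p k. p \<in> V \<Longrightarrow>
      card (contacts H X Y r b t k p) = card (contacts H X Y r' b' t' k p)"
    and eql: "\<And>p k. p \<in> V \<Longrightarrow>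
      card (contacts H X Y l b t k p) = card (contacts H X Y l' b' t' k p)"
  shows "\<And>p. p \<in> V \<Longrightarrow> b p = b' p \<and> t p = t' p" "\<And>q. q \<in> H \<Longrightarrow> l q = l' q \<and> r q = r' q"
proof -
  show V: "b p = b' p \<and> t p = t' p" if "p \<in> V" for p
    using ver_le[OF 1 2 eqr eql that] ver_le[OF 2 1 eqr[symmetric] eql[symmetric] that] by simp
  show "l q = l' q \<and> r q = r' q" if "q \<in> H" for q
    using hor_le[OF 1 2 V that] hor_le[OF 2 1 _ that] V by (metis order_antisym)
qed

section \<open>From rectangulations to configurations\<close>

lemma closed_segment_Pair_fst: "closed_segment (x, c) (x, d) = {x} \<times> closed_segment c (d::real)"
  for x :: real
proof -
  have "(1 - u) * a + u * a = a" for u a :: real by (simp add: algebra_simps)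
  then show ?thesis by (auto simp: closed_segment_def)
qed

lemma closed_segment_Pair_snd: "closed_segment (c, y) (d, y) = closed_segment c (d::real) \<times> {y}"
  for y :: real
proof -
  have "(1 - u) * a + u * a = a" for u a :: real by (simp add: algebra_simps)
  then show ?thesis by (auto simp: closed_segment_def)
qed

lemma axis_segment_cases:
  assumes "axis_segment s"
  obtains (horizontal) l r y where "l < r" "s = {l..r} \<times> {y}"
  | (vertical) x b t where "b < t" "s = {x} \<times> {b..t}"
proof -
  obtain a1 a2 b1 b2 where s: "s = closed_segment (a1, a2) (b1, b2)"
    "(a1, a2) \<noteq> (b1, b2)" "a1 = b1 \<or> a2 = b2"
    using assms by (auto simp: axis_segment_def)
  show thesis
  proof (cases "a1 = b1")
    case True
    then have "s = {a1} \<times> {min a2 b2..max a2 b2}" "min a2 b2 < max a2 b2"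
      using s by (auto simp: closed_segment_Pair_fst closed_segment_eq_real_ivl)
    then show thesis using vertical by blast
  next
    case False
    then have "s = {min a1 b1..max a1 b1} \<times> {a2}" "min a1 b1 < max a1 b1"
      using s by (auto simp: closed_segment_Pair_snd closed_segment_eq_real_ivl)
    then show thesis using horizontal by blast
  qed
qed

lemma rel_interior_horizontal: "rel_interior ({l..r::real} \<times> {y::real}) = {l<..<r} \<times> {y}" if "l < r"
  using that rel_interior_real_box[of l r] by (subst rel_interior_Times) auto

lemma rel_interior_vertical: "rel_interior ({x::real} \<times> {b..t::real}) = {x} \<times> {b<..<t}" if "b < t"
  using that rel_interior_real_box[of b t] by (subst rel_interior_Times) auto

text \<open>The open three quarters of a square around \<open>z\<close> are connected, hence lie in a single tile,
  and then so does the whole square, by convexity of the tile.\<close>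

lemma not_in_frontier_if_quadrant:
  fixes z :: "real \<times> real" and \<sigma> \<tau> e :: real
  assumes D: "D division_of B" "\<And>R. R \<in> D \<Longrightarrow> axis_rectangle R"
    and e: "0 < e" "{w. \<bar>fst w - fst z\<bar> < e \<and> \<bar>snd w - snd z\<bar> < e} \<subseteq> B"
    and sgn: "\<sigma> \<in> {1, -1}" "\<tau> \<in> {1, -1}"
    and quadrant: "\<And>R w. \<lbrakk>R \<in> D; w \<in> frontier R; \<bar>fst w - fst z\<bar> < e; \<bar>snd w - snd z\<bar> < e\<rbrakk>
      \<Longrightarrow> \<sigma> * (fst w - fst z) \<le> 0 \<and> \<tau> * (snd w - snd z) \<le> 0"
    and R': "R' \<in> D"
  shows "z \<notin> frontier R'"
proof
  assume z: "z \<in> frontier R'"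
  obtain x y where xy: "z = (x, y)" by fastforce
  \<comment> \<open>The quadrant that may contain frontier points is where both signed differences
    are at most \<open>0\<close>; \<open>W\<close> is the rest of the square, as two overlapping
    rectangles.\<close>
  define W where "W = ({u. \<bar>u - x\<bar> < e \<and> 0 < \<sigma> * (u - x)} \<times> {v. \<bar>v - y\<bar> < e}) \<union>
    ({u. \<bar>u - x\<bar> < e} \<times> {v. \<bar>v - y\<bar> < e \<and> 0 < \<tau> * (v - y)})"
  have iv: "connected {u. \<bar>u - x\<bar> < e}" for x :: real
    by (auto simp: connected_iff_interval abs_if split: if_splits)
  have iv': "connected {u. \<bar>u - x\<bar> < e \<and> 0 < \<sigma> * (u - x)}" if "\<sigma> \<in> {1, -1}" for x \<sigma> :: real
    using that by (auto simp: connected_iff_interval abs_if split: if_splits)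
  \<comment> \<open>\<open>?c\<close> lies in both rectangles and joins them. \<open>?u\<close> and
    \<open>?v\<close> are opposite each other about \<open>z\<close> in both coordinates, so a box
    containing both has \<open>z\<close> in its interior.\<close>
  let ?c = "(x + \<sigma> * (e/2), y + \<tau> * (e/2))"
  let ?u = "(x + \<sigma> * (e/2), y - \<tau> * (e/2))"
  let ?v = "(x - \<sigma> * (e/2), y + \<tau> * (e/2))"
  have pts: "?c \<in> W" "?u \<in> W" "?v \<in> W" using e(1) sgn by (auto simp: W_def)
  have "connected W" unfolding W_def
  proof (rule connected_Un)
    show "connected ({u. \<bar>u - x\<bar> < e \<and> 0 < \<sigma> * (u - x)} \<times> {v. \<bar>v - y\<bar> < e})"
      by (intro connected_Times iv iv' sgn)
    show "connected ({u. \<bar>u - x\<bar> < e} \<times> {v. \<bar>v - y\<bar> < e \<and> 0 < \<tau> * (v - y)})"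
      by (intro connected_Times iv iv' sgn)
    have "?c \<in> ({u. \<bar>u - x\<bar> < e \<and> 0 < \<sigma> * (u - x)} \<times> {v. \<bar>v - y\<bar> < e}) \<inter>
       ({u. \<bar>u - x\<bar> < e} \<times> {v. \<bar>v - y\<bar> < e \<and> 0 < \<tau> * (v - y)})"
      using e(1) sgn by auto
    then show "({u. \<bar>u - x\<bar> < e \<and> 0 < \<sigma> * (u - x)} \<times> {v. \<bar>v - y\<bar> < e}) \<inter>
       ({u. \<bar>u - x\<bar> < e} \<times> {v. \<bar>v - y\<bar> < e \<and> 0 < \<tau> * (v - y)}) \<noteq> {}" by blast
  qed
  moreover have front: "W \<inter> frontier R = {}" if "R \<in> D" for R
    using quadrant[OF that] by (fastforce simp: W_def xy)
  have "W \<subseteq> B" using e(2) by (auto simp: W_def xy)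
  with pts(1) obtain R where R: "R \<in> D" "?c \<in> R" using division_ofD(6)[OF D(1)] by blast
  ultimately have "W \<subseteq> R" using connected_Int_frontier[of W R] front[OF R(1)] pts(1) by blast
  moreover obtain a1 a2 b1 b2 where R_eq: "R = cbox (a1, a2) (b1, b2)"
    using D(2)[OF R(1)] by (metis axis_rectangle_def surj_pair)
  ultimately have "?u \<in> cbox (a1, a2) (b1, b2)" "?v \<in> cbox (a1, a2) (b1, b2)" using pts by auto
  then have "a1 < x \<and> x < b1 \<and> a2 < y \<and> y < b2" using e(1) sgn by auto
  then have zR: "z \<in> interior R"
    by (auto simp: R_eq cbox_Pair_eq interior_Times xy)
  then have "R' \<noteq> R" using z by (auto simp: frontier_def)
  \<comment> \<open>A tile is the closure of its interior, so the open set \<open>interior R\<close>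
    around \<open>z\<close> misses all of \<open>R'\<close>.\<close>
  then have "interior R \<inter> interior R' = {}" using division_ofD(5)[OF D(1)] R(1) R' by blast
  then have "interior R \<inter> closure (interior R') = {}" by (simp add: open_Int_closure_eq_empty)
  moreover obtain a b where "R' = cbox a b" "box a b \<noteq> {}"
    using D(2)[OF R'] unfolding axis_rectangle_def by blast
  then have "closure (interior R') = R'" by simp
  ultimately show False using zR z frontier_subset_closed[of R'] \<open>R' = cbox a b\<close> by auto
qed

section \<open>Ends of segments in a rectangulation\<close>

lemma rectangulation_finite:
  assumes "rectangulation B P S" "finite P"
  shows "finite S"
proof -
  obtain f where f: "\<And>s. s \<in> S \<Longrightarrow> f s \<in> P \<and> f s \<in> s"
    using assms(1) unfolding rectangulation_def by metis
  have "inj_on f S"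
    using f assms(1) unfolding rectangulation_def inj_on_def by metis
  then show ?thesis using f assms(2) by (metis finite_imageD finite_subset image_subset_iff)
qed

text \<open>Used to show that two segments on a common line coincide: their points would share a
  coordinate.\<close>

lemma rectangulation_eqI:
  assumes "rectangulation B P S" "general_position P" "s \<in> S" "t \<in> S"
    and "p \<in> P" "p \<in> s" "q \<in> P" "q \<in> t" "fst p = fst q \<or> snd p = snd q"
  shows "s = t"
proof -
  have "p = q" using assms(2,5,7,9) by (auto simp: general_position_def inj_on_def)
  then show ?thesis using assms unfolding rectangulation_def by metis
qed

text \<open>Otherwise \<open>z\<close> is an endpoint of every segment through it. Each line carries
  at most one segment, so those at \<open>z\<close> fit into one closed quadrant, and then
  \<open>z\<close> cannot be on the frontier of a tile. This excludes both dangling ends and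
  L-shaped corners.\<close>

lemma rectangulation_in_rel_interior:
  assumes rect: "rectangulation B P S" and gp: "general_position P"
    and z: "z \<in> interior B" "s \<in> S" "z \<in> s"
  shows "\<exists>t\<in>S. z \<in> rel_interior t"
proof (rule ccontr)
  assume contra: "\<not> (\<exists>t\<in>S. z \<in> rel_interior t)"
  have seg: "\<And>t. t \<in> S \<Longrightarrow> axis_segment t" and one: "\<And>t. t \<in> S \<Longrightarrow> \<exists>p. p \<in> P \<and> p \<in> t"
    using rect unfolding rectangulation_def by (blast, metis)
  obtain D where D: "D division_of B" "\<And>R. R \<in> D \<Longrightarrow> axis_rectangle R"
    "(\<Union>R\<in>D. frontier R) = frontier B \<union> \<Union>S"
    using rect by (auto simp: rectangulation_def cuts_into_rectangles_def)
  have fin: "finite S" using rectangulation_finite[OF rect] gp by (simp add: general_position_def)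
  \<comment> \<open>If one segment leaves \<open>z\<close> to the right and another to the left,
    they share a line, hence are equal, and \<open>z\<close> is in the relative interior. So one
    horizontal direction is free; \<open>\<sigma>\<close> points to it.\<close>
  obtain \<sigma> :: real where \<sigma>: "\<sigma> \<in> {1, -1}"
    "\<And>t w. t \<in> S \<Longrightarrow> z \<in> t \<Longrightarrow> w \<in> t \<Longrightarrow> \<sigma> * (fst w - fst z) \<le> 0"
  proof (cases "\<exists>t\<in>S. z \<in> t \<and> (\<exists>w\<in>t. fst z < fst w)")
    case True
    then obtain t w where t: "t \<in> S" "z \<in> t" "w \<in> t" "fst z < fst w" by blast
    have "- 1 * (fst w' - fst z) \<le> 0" if t': "t' \<in> S" "z \<in> t'" "w' \<in> t'" for t' w'
    proof (rule ccontr)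
      assume "\<not> ?thesis"
      then have lt: "fst w' < fst z" by simp
      obtain l r y where h: "l < r" "t = {l..r} \<times> {y}"
        using seg[OF t(1)] t by (cases rule: axis_segment_cases) auto
      obtain l' r' y' where h': "l' < r'" "t' = {l'..r'} \<times> {y'}"
        using seg[OF t'(1)] t' lt by (cases rule: axis_segment_cases) auto
      obtain p p' where p: "p \<in> P" "p \<in> t" "p' \<in> P" "p' \<in> t'"
        using one t(1) t'(1) by metis
      then have "snd p' = snd p" using h h' t(2) t'(2) by auto
      then have "t' = t"
        using rectangulation_eqI[OF rect gp t'(1) t(1) p(3,4,1,2)] by blast
      then have "z \<in> rel_interior t" using h t t' lt by (auto simp: rel_interior_horizontal)
      with contra t(1) show False by blast
    qed
    then show thesis using that[of "-1"] by blast
  next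
    case False
    then show thesis using that[of 1] by force
  qed
  obtain \<tau> :: real where \<tau>: "\<tau> \<in> {1, -1}"
    "\<And>t w. t \<in> S \<Longrightarrow> z \<in> t \<Longrightarrow> w \<in> t \<Longrightarrow> \<tau> * (snd w - snd z) \<le> 0"
  proof (cases "\<exists>t\<in>S. z \<in> t \<and> (\<exists>w\<in>t. snd z < snd w)")
    case True
    then obtain t w where t: "t \<in> S" "z \<in> t" "w \<in> t" "snd z < snd w" by blast
    have "- 1 * (snd w' - snd z) \<le> 0" if t': "t' \<in> S" "z \<in> t'" "w' \<in> t'" for t' w'
    proof (rule ccontr)
      assume "\<not> ?thesis"
      then have lt: "snd w' < snd z" by simp
      obtain x b c where h: "b < c" "t = {x} \<times> {b..c}"
        using seg[OF t(1)] t by (cases rule: axis_segment_cases) auto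
      obtain x' b' c' where h': "b' < c'" "t' = {x'} \<times> {b'..c'}"
        using seg[OF t'(1)] t' lt by (cases rule: axis_segment_cases) auto
      obtain p p' where p: "p \<in> P" "p \<in> t" "p' \<in> P" "p' \<in> t'"
        using one t(1) t'(1) by metis
      then have "fst p' = fst p" using h h' t(2) t'(2) by auto
      then have "t' = t"
        using rectangulation_eqI[OF rect gp t'(1) t(1) p(3,4,1,2)] by blast
      then have "z \<in> rel_interior t" using h t t' lt by (auto simp: rel_interior_vertical)
      with contra t(1) show False by blast
    qed
    then show thesis using that[of "-1"] by blast
  next
    case False
    then show thesis using that[of 1] by force
  qed
  \<comment> \<open>Finitely many closed segments miss \<open>z\<close>, so a small square around
    \<open>z\<close> avoids them and the frontier of \<open>B\<close>; frontier points of tiles in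
    it lie on segments through \<open>z\<close>.\<close>
  define U where "U = interior B - \<Union>{t \<in> S. z \<notin> t}"
  have "closed t" if "t \<in> S" for t
    using seg[OF that] by (auto simp: axis_segment_def)
  then have "closed (\<Union>{t \<in> S. z \<notin> t})" using fin by (intro closed_Union) auto
  then have "open U" "z \<in> U" using z by (auto simp: U_def open_Diff)
  then obtain A A' where A: "open A" "open A'" "z \<in> A \<times> A'" "A \<times> A' \<subseteq> U"
    by (metis open_prod_elim)
  then have "fst z \<in> A" "snd z \<in> A'" by auto
  then obtain e1 e2 where e: "0 < e1" "\<And>u. \<bar>u - fst z\<bar> < e1 \<Longrightarrow> u \<in> A"
     "0 < e2" "\<And>u. \<bar>u - snd z\<bar> < e2 \<Longrightarrow> u \<in> A'"
    using A(1,2) unfolding open_real by metis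
  define e where "e = min e1 e2"
  have sub: "w \<in> U" if "\<bar>fst w - fst z\<bar> < e" "\<bar>snd w - snd z\<bar> < e" for w
    using that e A(4) by (cases w) (auto simp: e_def)
  obtain R where R: "R \<in> D" "z \<in> frontier R" using D(3) z by blast
  have "z \<notin> frontier R"
  proof (rule not_in_frontier_if_quadrant[OF D(1,2) _ _ \<sigma>(1) \<tau>(1) _ R(1)])
    show "0 < e" using e by (simp add: e_def)
    show "{w. \<bar>fst w - fst z\<bar> < e \<and> \<bar>snd w - snd z\<bar> < e} \<subseteq> B"
      using sub interior_subset by (fastforce simp: U_def)
    fix R w assume w: "R \<in> D" "w \<in> frontier R" "\<bar>fst w - fst z\<bar> < e" "\<bar>snd w - snd z\<bar> < e"
    then have "w \<in> U" using sub by blast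
    moreover have "w \<in> frontier B \<union> \<Union>S" using D(3) w by blast
    ultimately obtain t where "t \<in> S" "z \<in> t" "w \<in> t" by (auto simp: U_def frontier_def)
    then show "\<sigma> * (fst w - fst z) \<le> 0 \<and> \<tau> * (snd w - snd z) \<le> 0"
      using \<sigma>(2) \<tau>(2) by blast
  qed auto
  with R(2) show False by blast
qed

text \<open>An end in the interior of \<open>B\<close> lies in the relative interior of some
  segment, which must be perpendicular; absence of crossings is disjointness of relative
  interiors.\<close>

lemma rectangulation_floorplan:
  assumes rect: "rectangulation (cbox (x0, y0) (x1, y1)) P S" and gp: "general_position P"
    and P: "P \<subseteq> interior (cbox (x0, y0) (x1, y1))"
  obtains H V l r b t where "H \<union> V = P" "floorplan H V fst snd x0 x1 y0 y1 l r b t"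
    "S = (\<lambda>q. {l q..r q} \<times> {snd q}) ` H \<union> (\<lambda>p. {fst p} \<times> {b p..t p}) ` V"
proof -
  let ?B = "cbox (x0, y0) (x1, y1)"
  have seg: "\<And>s. s \<in> S \<Longrightarrow> axis_segment s" and sub: "\<And>s. s \<in> S \<Longrightarrow> s \<subseteq> ?B"
    using rect by (simp_all add: rectangulation_def)
  have one: "\<And>s. s \<in> S \<Longrightarrow> \<exists>!p. p \<in> P \<and> p \<in> s"
    using rect unfolding rectangulation_def by (elim conjE bspec)
  have ex1: "\<And>p. p \<in> P \<Longrightarrow> \<exists>!s. s \<in> S \<and> p \<in> s"
    using rect unfolding rectangulation_def by (elim conjE bspec)
  have disj: "pairwise (\<lambda>s t. disjnt (rel_interior s) (rel_interior t)) S"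
    using rect by (simp add: rectangulation_def)
  have int: "interior ?B = {x0<..<x1} \<times> {y0<..<y1}"
    by (simp add: cbox_Pair_eq interior_Times)
  \<comment> \<open>\<open>f\<close> maps each point to its segment and is a bijection from
    \<open>P\<close> to \<open>S\<close>.\<close>
  obtain f where f: "\<And>p. p \<in> P \<Longrightarrow> f p \<in> S \<and> p \<in> f p" using ex1 by metis
  have inj: "p = q" if "p \<in> P" "q \<in> P" "f p = f q" for p q
    using that f one by metis
  have "s \<in> f ` P" if s: "s \<in> S" for s
  proof -
    obtain p where p: "p \<in> P" "p \<in> s" using one[OF s] by blast
    then have "f p = s" using ex1[of p] f[of p] s by blast
    then show ?thesis using p(1) by blast
  qed
  then have S: "S = f ` P" using f by blast
  define H where "H = {p \<in> P. \<exists>l r. l < r \<and> f p = {l..r} \<times> {snd p}}"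
  define V where "V = P - H"
  have "\<exists>b t. b < t \<and> f p = {fst p} \<times> {b..t}" if p: "p \<in> V" for p
  proof -
    have "axis_segment (f p)" "p \<in> f p" using p f[of p] seg[of "f p"] unfolding V_def by blast+
    then show ?thesis
    proof (cases rule: axis_segment_cases)
      case (horizontal l r y)
      then have "y = snd p" using \<open>p \<in> f p\<close> by auto
      then have "p \<in> H" using p horizontal unfolding H_def V_def by blast
      then show ?thesis using p by (simp add: V_def)
    next
      case (vertical x b t)
      then have "x = fst p" using \<open>p \<in> f p\<close> by auto
      then show ?thesis using vertical by blast
    qed
  qed
  then obtain b where "\<forall>p\<in>V. \<exists>t. b p < t \<and> f p = {fst p} \<times> {b p..t}"
    using bchoice[of V "\<lambda>p b. \<exists>t. b < t \<and> f p = {fst p} \<times> {b..t}"] by blast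
  then obtain t where V: "\<And>p. p \<in> V \<Longrightarrow> b p < t p \<and> f p = {fst p} \<times> {b p..t p}"
    using bchoice[of V "\<lambda>p t. b p < t \<and> f p = {fst p} \<times> {b p..t}"] by blast
  have "\<forall>q\<in>H. \<exists>l r. l < r \<and> f q = {l..r} \<times> {snd q}" unfolding H_def by blast
  then obtain l where "\<forall>q\<in>H. \<exists>r. l q < r \<and> f q = {l q..r} \<times> {snd q}"
    using bchoice[of H "\<lambda>q l. \<exists>r. l < r \<and> f q = {l..r} \<times> {snd q}"] by blast
  then obtain r where H: "\<And>q. q \<in> H \<Longrightarrow> l q < r q \<and> f q = {l q..r q} \<times> {snd q}"
    using bchoice[of H "\<lambda>q r. l q < r \<and> f q = {l q..r} \<times> {snd q}"] by blast
  have HV: "H \<union> V = P" "H \<inter> V = {}" by (auto simp: V_def H_def)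
  have memH: "q \<in> P" "fst q \<in> {l q..r q}" "y0 < snd q" "snd q < y1" "x0 \<le> l q" "r q \<le> x1"
    if q: "q \<in> H" for q
  proof -
    show "q \<in> P" using q HV by blast
    then show "fst q \<in> {l q..r q}" "y0 < snd q" "snd q < y1"
      using f H[OF q] P int by (force, force, force)
    have "(l q, snd q) \<in> f q" "(r q, snd q) \<in> f q" using H[OF q] by auto
    then have "(l q, snd q) \<in> ?B" "(r q, snd q) \<in> ?B" using sub f \<open>q \<in> P\<close> by blast+
    then show "x0 \<le> l q" "r q \<le> x1" by auto
  qed
  have memV: "p \<in> P" "snd p \<in> {b p..t p}" "x0 < fst p" "fst p < x1" "y0 \<le> b p" "t p \<le> y1"
    if p: "p \<in> V" for p
  proof -
    show "p \<in> P" using p HV by blast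
    then show "snd p \<in> {b p..t p}" "x0 < fst p" "fst p < x1"
      using f V[OF p] P int by (force, force, force)
    have "(fst p, b p) \<in> f p" "(fst p, t p) \<in> f p" using V[OF p] by auto
    then have "(fst p, b p) \<in> ?B" "(fst p, t p) \<in> ?B" using sub f \<open>p \<in> P\<close> by blast+
    then show "y0 \<le> b p" "t p \<le> y1" by auto
  qed
  have riH: "rel_interior (f q) = {l q<..<r q} \<times> {snd q}" if "q \<in> H" for q
    using H[OF that] by (simp add: rel_interior_horizontal)
  have riV: "rel_interior (f p) = {fst p} \<times> {b p<..<t p}" if "p \<in> V" for p
    using V[OF that] by (simp add: rel_interior_vertical)
  have gp': "finite P" "inj_on fst P" "inj_on snd P" using gp by (auto simp: general_position_def)
  have H_end: "\<exists>p\<in>V. fst p = x \<and> b p < snd q \<and> snd q < t p"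
    if q: "q \<in> H" and x: "x = l q \<or> x = r q" "x0 < x" "x < x1" for q x
  proof -
    have "(x, snd q) \<in> f q" "(x, snd q) \<in> interior ?B"
      using x memH[OF q] H[OF q] unfolding int by auto
    then obtain p where p: "p \<in> P" "(x, snd q) \<in> rel_interior (f p)"
      using rectangulation_in_rel_interior[OF rect gp] f memH(1)[OF q] S by blast
    \<comment> \<open>A horizontal segment at this height belongs to the same point, so it is
      \<open>f q\<close> itself, whose end is not in its relative interior.\<close>
    have "p \<notin> H"
    proof
      assume "p \<in> H"
      then have "p = q" using p riH memH(1)[OF q] gp'(3) by (auto simp: inj_on_def)
      then show False using x p riH[OF q] by auto
    qed
    then have "p \<in> V" using p(1) HV by blast
    then show ?thesis using p riV by auto
  qed
  have V_end: "\<exists>q\<in>H. snd q = y \<and> l q < fst p \<and> fst p < r q"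
    if p: "p \<in> V" and y: "y = b p \<or> y = t p" "y0 < y" "y < y1" for p y
  proof -
    have "(fst p, y) \<in> f p" "(fst p, y) \<in> interior ?B"
      using y memV[OF p] V[OF p] unfolding int by auto
    then obtain q where q: "q \<in> P" "(fst p, y) \<in> rel_interior (f q)"
      using rectangulation_in_rel_interior[OF rect gp] f memV(1)[OF p] S by blast
    have "q \<notin> V"
    proof
      assume "q \<in> V"
      then have "q = p" using q riV memV(1)[OF p] gp'(2) by (auto simp: inj_on_def)
      then show False using y q riV[OF p] by auto
    qed
    then have "q \<in> H" using q(1) HV by blast
    then show ?thesis using q riH by auto
  qed
  have "floorplan H V fst snd x0 x1 y0 y1 l r b t"
  proof
    show "finite H" "finite V" using gp'(1) HV(1) finite_Un by blast+
    show "inj_on fst (H \<union> V)" "inj_on snd (H \<union> V)" "H \<inter> V = {}" using gp' HV by auto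
    show "l q \<le> fst q \<and> fst q \<le> r q" "x0 \<le> l q \<and> r q \<le> x1" if "q \<in> H" for q
      using memH[OF that] by auto
    show "b p \<le> snd p \<and> snd p \<le> t p" "x0 < fst p \<and> fst p < x1 \<and> y0 \<le> b p \<and> t p \<le> y1"
      if "p \<in> V" for p using memV[OF that] by auto
    show False if "q \<in> H" "p \<in> V" "l q < fst p" "fst p < r q" "b p < snd q" "snd q < t p" for p q
    proof -
      have "f p \<noteq> f q" using inj[OF memV(1) memH(1)] that HV(2) by blast
      then have "disjnt (rel_interior (f p)) (rel_interior (f q))"
        using disj f memV(1) memH(1) that by (auto simp: pairwise_def)
      moreover have "(fst p, snd q) \<in> rel_interior (f p) \<inter> rel_interior (f q)"
        using that riV riH by auto
      ultimately show False by (auto simp: disjnt_def)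
    qed
    show "\<exists>p\<in>V. fst p = r q \<and> b p < snd q \<and> snd q < t p" if "q \<in> H" "r q \<noteq> x1" for q
      using that memH[OF that(1)] H[OF that(1)] by (intro H_end) auto
    show "\<exists>p\<in>V. fst p = l q \<and> b p < snd q \<and> snd q < t p" if "q \<in> H" "l q \<noteq> x0" for q
      using that memH[OF that(1)] H[OF that(1)] by (intro H_end) auto
    show "\<exists>q\<in>H. snd q = t p \<and> l q < fst p \<and> fst p < r q" if "p \<in> V" "t p \<noteq> y1" for p
      using that memV[OF that(1)] V[OF that(1)] by (intro V_end) auto
    show "\<exists>q\<in>H. snd q = b p \<and> l q < fst p \<and> fst p < r q" if "p \<in> V" "b p \<noteq> y0" for p
      using that memV[OF that(1)] V[OF that(1)] by (intro V_end) auto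
  qed
  moreover have "S = (\<lambda>q. {l q..r q} \<times> {snd q}) ` H \<union> (\<lambda>p. {fst p} \<times> {b p..t p}) ` V"
    unfolding S HV(1)[symmetric] image_Un using H V by (intro arg_cong2[of _ _ _ _ "(\<union>)"] image_cong) auto
  ultimately show thesis using that HV(1) by blast
qed

section \<open>Counting\<close>

text \<open>Each horizontal segment has a single end of the kind \<open>e\<close>, and by
  injectivity of \<open>X\<close> that end touches at most one vertical segment, on one side of its
  point.\<close>

lemma sum_contacts_le:
  assumes "finite H" "finite V" "inj_on X V"
  shows "(\<Sum>p\<in>V. card (contacts H X Y e b t True p) + card (contacts H X Y e b t False p)) \<le> card H"
proof -
  let ?U = "\<lambda>p. contacts H X Y e b t True p \<union> contacts H X Y e b t False p"
  have "(\<Sum>p\<in>V. card (contacts H X Y e b t True p) + card (contacts H X Y e b t False p))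
      = (\<Sum>p\<in>V. card (?U p))"
    by (intro sum.cong refl card_Un_disjoint[symmetric] finite_contacts assms)
      (auto simp: contacts_def)
  also have "\<dots> = card (\<Union>p\<in>V. ?U p)"
    using assms by (intro card_UN_disjoint[symmetric] ballI impI)
      (auto simp: finite_contacts, auto simp: contacts_def inj_on_def)
  also have "\<dots> \<le> card H"
    using assms by (intro card_mono) (auto simp: contacts_def)
  finally show ?thesis .
qed

section \<open>Codes and their weights\<close>

text \<open>\<open>None\<close> marks a horizontal segment. The restriction makes codes extensional,
  so that they are elements of a finite product of sets.\<close>

definition signature where
  "signature H V X Y l r b t = (\<lambda>p\<in>H \<union> V. if p \<in> V
     then Some (card (contacts H X Y l b t True p), card (contacts H X Y l b t False p),
                card (contacts H X Y r b t True p), card (contacts H X Y r b t False p))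
     else None)"

lemma signature_inject:
  assumes 1: "floorplan H V X Y x0 x1 y0 y1 l r b t"
    and 2: "floorplan H' V' X Y x0 x1 y0 y1 l' r' b' t'"
    and dom: "H \<union> V = H' \<union> V'"
    and eq: "signature H V X Y l r b t = signature H' V' X Y l' r' b' t'"
  shows "H = H'" "V = V'" "\<And>p. p \<in> V \<Longrightarrow> b p = b' p \<and> t p = t' p"
    "\<And>q. q \<in> H \<Longrightarrow> l q = l' q \<and> r q = r' q"
proof -
  have "p \<in> V \<longleftrightarrow> p \<in> V'" for p
    using fun_cong[OF eq, of p] dom by (auto simp: signature_def restrict_def split: if_splits)
  then show V: "V = V'" by blast
  then show H: "H = H'"
    using dom floorplan.disjoint[OF 1] floorplan.disjoint[OF 2] by blast
  have "card (contacts H X Y e b t k p) = card (contacts H X Y e' b' t' k p)"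
    if "p \<in> V" "(e, e') = (l, l') \<or> (e, e') = (r, r')" for p k e e'
    using fun_cong[OF eq, of p] that by (cases k) (auto simp: signature_def V[symmetric] H[symmetric])
  then show "\<And>p. p \<in> V \<Longrightarrow> b p = b' p \<and> t p = t' p" "\<And>q. q \<in> H \<Longrightarrow> l q = l' q \<and> r q = r' q"
    using floorplan_unique[OF 1 2[folded H V]] by blast+
qed

definition weight :: "(nat \<times> nat \<times> nat \<times> nat) option \<Rightarrow> real" where
  "weight c = (case c of None \<Rightarrow> 9 | Some (i, j, k, m) \<Rightarrow> (1/3) ^ (i + j + k + m))"

text \<open>Every contact costs a factor \<open>1/3\<close> and uses one of the
  \<open>2 * card H\<close> horizontal ends; the factors \<open>9\<close> pay for all of
  these.\<close>

lemma signature_weight: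
  assumes "floorplan H V X Y x0 x1 y0 y1 l r b t"
  shows "1 \<le> (\<Prod>p\<in>H \<union> V. weight (signature H V X Y l r b t p))"
proof -
  interpret floorplan H V X Y x0 x1 y0 y1 l r b t by fact
  let ?w = "\<lambda>p. weight (signature H V X Y l r b t p)"
  define c where "c e p = card (contacts H X Y e b t True p) + card (contacts H X Y e b t False p)"
    for e p
  have inj: "inj_on X V" using inj_X by (rule inj_on_subset) auto
  have "(\<Sum>p\<in>V. c l p + c r p) \<le> card H + card H"
    using sum_contacts_le[OF finite_H finite_V inj, where e = l]
      sum_contacts_le[OF finite_H finite_V inj, where e = r]
    unfolding c_def sum.distrib by (intro add_mono) (simp_all add: sum.distrib)
  then have "(1/3 :: real) ^ (2 * card H) \<le> (1/3) ^ (\<Sum>p\<in>V. c l p + c r p)"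
    by (intro power_decreasing) auto
  also have "\<dots> = (\<Prod>p\<in>V. ?w p)"
    unfolding power_sum by (intro prod.cong) (auto simp: signature_def weight_def c_def add.assoc)
  finally have V: "(1/9 :: real) ^ card H \<le> (\<Prod>p\<in>V. ?w p)"
    by (simp add: power_mult power2_eq_square)
  have "(\<Prod>p\<in>H. ?w p) = (\<Prod>p\<in>H. 9)"
    using disjoint by (intro prod.cong) (auto simp: signature_def weight_def)
  then have "(\<Prod>p\<in>H \<union> V. ?w p) = 9 ^ card H * (\<Prod>p\<in>V. ?w p)"
    using finite_H finite_V disjoint by (simp add: prod.union_disjoint)
  moreover have "9 ^ card H * (1/9 :: real) ^ card H \<le> 9 ^ card H * (\<Prod>p\<in>V. ?w p)"
    using V by (intro mult_left_mono) auto
  ultimately show ?thesis by (simp flip: power_mult_distrib)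
qed

text \<open>Bounding the counts by \<open>N\<close> keeps the alphabet finite; the bound on its
  total weight does not depend on \<open>N\<close>.\<close>

definition small_signatures :: "nat \<Rightarrow> (nat \<times> nat \<times> nat \<times> nat) option set" where
  "small_signatures N = insert None (Some ` ({..N} \<times> {..N} \<times> {..N} \<times> {..N}))"

lemma signature_in:
  assumes "finite H" "finite V"
  shows "signature H V X Y l r b t \<in> (H \<union> V) \<rightarrow>\<^sub>E small_signatures (card (H \<union> V))"
proof -
  have "card (contacts H X Y e b t k p) \<le> card (H \<union> V)" for e k p
    using assms by (intro card_mono) (auto simp: contacts_def)
  then show ?thesis by (auto simp: signature_def small_signatures_def)
qed

text \<open>The sum over the four counts factors into geometric sums of at most \<open>3/2\<close>
  each, and 9 + 81/16 = 225/16.\<close>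

lemma sum_weight_le: "(\<Sum>c\<in>small_signatures N. weight c) \<le> 225/16"
proof -
  define g :: real where "g = (\<Sum>i\<le>N. (1/3) ^ i)"
  have g: "0 \<le> g" "g \<le> 3/2"
  proof -
    show "0 \<le> g" by (simp add: g_def sum_nonneg)
    have "g \<le> (\<Sum>i. (1/3) ^ i)" unfolding g_def
      by (intro sum_le_suminf) (auto simp: summable_geometric)
    then show "g \<le> 3/2" by (simp add: suminf_geometric)
  qed
  have "(\<Sum>c\<in>small_signatures N. weight c) = 9 + (\<Sum>c\<in>Some ` ({..N} \<times> {..N} \<times> {..N} \<times> {..N}). weight c)"
    unfolding small_signatures_def by (subst sum.insert) (auto simp: weight_def)
  also have "(\<Sum>c\<in>Some ` ({..N} \<times> {..N} \<times> {..N} \<times> {..N}). weight c)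
      = (\<Sum>(i, j, k, m)\<in>{..N} \<times> {..N} \<times> {..N} \<times> {..N}. (1/3) ^ i * ((1/3) ^ j * ((1/3) ^ k * (1/3) ^ m)))"
    by (subst sum.reindex) (auto simp: weight_def power_add mult.assoc intro!: sum.cong)
  also have "\<dots> = g * (g * (g * g))"
    by (simp only: g_def sum_product sum.cartesian_product case_prod_unfold fst_conv snd_conv)
  also have "g * (g * (g * g)) \<le> 3/2 * (3/2 * (3/2 * (3/2)))"
    using g by (intro mult_mono) auto
  finally show ?thesis by simp
qed

text \<open>Every code in \<open>F\<close> weighs at least \<open>1\<close>, so
  \<open>card F\<close> is at most the total weight of all functions, which factors over the
  points.\<close>

lemma card_signatures_le:
  assumes P: "finite P"
    and F: "F \<subseteq> {f \<in> P \<rightarrow>\<^sub>E small_signatures N. 1 \<le> (\<Prod>p\<in>P. weight (f p))}"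
  shows "finite F" "real (card F) \<le> (225/16) ^ card P"
proof -
  have fin: "finite (small_signatures N)" by (simp add: small_signatures_def)
  then have fin': "finite (P \<rightarrow>\<^sub>E small_signatures N)" using P by (intro finite_PiE) auto
  then show "finite F" using F by (rule_tac finite_subset) auto
  have pos: "0 \<le> weight c" for c by (auto simp: weight_def split: option.splits)
  have "real (card F) = (\<Sum>f\<in>F. 1)" by simp
  also have "\<dots> \<le> (\<Sum>f\<in>F. \<Prod>p\<in>P. weight (f p))" using F by (intro sum_mono) auto
  also have "\<dots> \<le> (\<Sum>f\<in>P \<rightarrow>\<^sub>E small_signatures N. \<Prod>p\<in>P. weight (f p))"
    using F fin' pos by (intro sum_mono2) (auto intro!: prod_nonneg)
  also have "\<dots> = (\<Prod>p\<in>P. \<Sum>c\<in>small_signatures N. weight c)"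
    using P fin by (intro prod_sum_PiE[symmetric]) auto
  also have "\<dots> \<le> (\<Prod>p\<in>P. 225/16)"
    using pos sum_weight_le by (intro prod_mono) (auto intro!: sum_nonneg)
  finally show "real (card F) \<le> (225/16) ^ card P" by simp
qed

section \<open>The bound for a fixed point set\<close>

lemma rectangulations_le:
  assumes B: "axis_rectangle B" and gp: "general_position P" and P: "P \<subseteq> interior B"
  shows "finite {S. rectangulation B P S}" "card {S. rectangulation B P S} \<le> 17 ^ card P"
proof -
  obtain x0 y0 x1 y1 where B_eq: "B = cbox (x0, y0) (x1, y1)"
    using B by (metis axis_rectangle_def surj_pair)
  have fin: "finite P" using gp by (simp add: general_position_def)
  \<comment> \<open>The configuration of \<open>S\<close> is only known to exist, so coding is a
    relation and \<open>g\<close> selects a code. For injectivity of \<open>g\<close> it suffices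
    that a code belongs to at most one \<open>S\<close>.\<close>
  define encodes where "encodes S f \<longleftrightarrow> (\<exists>H V l r b t. H \<union> V = P \<and>
      floorplan H V fst snd x0 x1 y0 y1 l r b t \<and>
      S = (\<lambda>q. {l q..r q} \<times> {snd q}) ` H \<union> (\<lambda>p. {fst p} \<times> {b p..t p}) ` V \<and>
      f = signature H V fst snd l r b t)" for S f
  have "\<exists>f. encodes S f" if "rectangulation B P S" for S
    by (rule rectangulation_floorplan[OF that[unfolded B_eq] gp P[unfolded B_eq]])
      (unfold encodes_def, intro exI conjI, assumption+, rule refl)
  then obtain g where g: "\<And>S. rectangulation B P S \<Longrightarrow> encodes S (g S)" by metis
  have unique: "S = S'" if S: "encodes S f" and S': "encodes S' f" for S S' f
  proof -
    obtain H V l r b t where 1: "H \<union> V = P" "floorplan H V fst snd x0 x1 y0 y1 l r b t"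
      "S = (\<lambda>q. {l q..r q} \<times> {snd q}) ` H \<union> (\<lambda>p. {fst p} \<times> {b p..t p}) ` V"
      "f = signature H V fst snd l r b t" using S unfolding encodes_def
      by (elim exE conjE) (rule that)
    obtain H' V' l' r' b' t' where 2: "H' \<union> V' = P" "floorplan H' V' fst snd x0 x1 y0 y1 l' r' b' t'"
      "S' = (\<lambda>q. {l' q..r' q} \<times> {snd q}) ` H' \<union> (\<lambda>p. {fst p} \<times> {b' p..t' p}) ` V'"
      "f = signature H' V' fst snd l' r' b' t'" using S' unfolding encodes_def
      by (elim exE conjE) (rule that)
    have dom: "H \<union> V = H' \<union> V'" and eq: "signature H V fst snd l r b t = signature H' V' fst snd l' r' b' t'"
      using 1 2 by simp_all
    note same = signature_inject[OF 1(2) 2(2) dom eq]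
    show "S = S'" unfolding 1(3) 2(3) same(1,2)[symmetric]
      by (intro arg_cong2[of _ _ _ _ "(\<union>)"] image_cong) (auto simp: same(3,4))
  qed
  let ?F = "g ` {S. rectangulation B P S}"
  have inj: "inj_on g {S. rectangulation B P S}"
  proof (rule inj_onI)
    fix S S' assume "S \<in> {S. rectangulation B P S}" "S' \<in> {S. rectangulation B P S}" "g S = g S'"
    then have "encodes S (g S)" "encodes S' (g S)" using g[of S] g[of S'] by simp_all
    then show "S = S'" by (rule unique)
  qed
  have "f \<in> P \<rightarrow>\<^sub>E small_signatures (card P) \<and> 1 \<le> (\<Prod>p\<in>P. weight (f p))" if enc: "encodes S f" for S f
  proof -
    obtain H V l r b t where 1: "H \<union> V = P" "floorplan H V fst snd x0 x1 y0 y1 l r b t"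
      "f = signature H V fst snd l r b t" using enc unfolding encodes_def
      by (elim exE conjE) (rule that)
    show ?thesis unfolding 1(1)[symmetric] 1(3)
      by (intro conjI signature_in signature_weight[OF 1(2)] floorplan.finite_H[OF 1(2)]
          floorplan.finite_V[OF 1(2)])
  qed
  then have F: "?F \<subseteq> {f \<in> P \<rightarrow>\<^sub>E small_signatures (card P). 1 \<le> (\<Prod>p\<in>P. weight (f p))}"
    using g by blast
  note F_card = card_signatures_le[OF fin F]
  show "finite {S. rectangulation B P S}" using F_card(1) inj by (rule finite_imageD)
  have "real (card {S. rectangulation B P S}) \<le> (225/16) ^ card P"
    using F_card(2) card_image[OF inj] by simp
  also have "\<dots> \<le> 17 ^ card P" by (intro power_mono) auto
  also have "\<dots> = real (17 ^ card P)" by simp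
  finally show "card {S. rectangulation B P S} \<le> 17 ^ card P" by linarith
qed

theorem theorem1:
  fixes n :: nat
  assumes "n \<ge> 1"
  shows "rc_max n \<le> 17 ^ n"
  unfolding rc_max_def
proof (rule Sup_least)
  fix c assume "c \<in> {rc B P |B P. axis_rectangle B \<and> general_position P \<and> P \<subseteq> interior B \<and> card P = n}"
  then obtain B P where c: "c = rc B P" "axis_rectangle B" "general_position P" "P \<subseteq> interior B"
    "card P = n" by blast
  \<comment> \<open>Finiteness rules out the infinite branch of \<open>rc\<close>.\<close>
  have "c \<le> enat (17 ^ n)" using rectangulations_le[OF c(2-4)] c(1,5) by (simp add: rc_def)
  also have "enat (17 ^ n) = 17 ^ n"
    by (metis of_nat_eq_enat of_nat_numeral of_nat_power)
  finally show "c \<le> 17 ^ n" .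
qed

end
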